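(* Let $n_1,n_2,p\in\mathbb{N}$ and let $S_k\in\mathbb{S}_p(\mathbb{R})$ for $k=-2n_1,-2n_1+1,\ldots,2n_2$. Assume that the block matrix $$(S_{i+j-2-2n_1})_{i,j=1}^{n_1+n_2+1}$$ is positive definite. Then there exists a positive $\mathbb{S}_p(\mathbb{R})$-valued measure $\mu$ on $\mathbb{R}$ such that $S_k=\int_{\mathbb{R}}x^k\,d\mu$ for each $k=-2n_1,-2n_1+1,\ldots,2n_2$.
   Context: $\mathbb{N}=\{1,2,\ldots\}$. $\mathbb{S}_p(\mathbb{R})$ is the space of real symmetric $p\times p$ matrices. The block matrix has $(n_1+n_2+1)\times(n_1+n_2+1)$ blocks of size $p\times p$ and is regarded as a real square matrix of size $(n_1+n_2+1)p$. A positive $\mathbb{S}_p(\mathbb{R})$-valued measure is a map $\mu=(\mu_{ij})_{i,j=1}^p$ from the Borel $\sigma$-algebra of $\mathbb{R}$ to $\mathbb{S}_p(\mathbb{R})$ such that each $\mu_{ij}$ is a real (signed) measure and $\mu(\Delta)$ is positive semidefinite for every Borel set $\Delta$. Integrals are taken entrywise: $\int f\,d\mu=(\int f\,d\mu_{ij})_{i,j}$, where $f$ is required to be integrable with respect to the trace measure $\sum_i\mu_{ii}$. Since $x^k$ with $k<0$ is not defined at $x=0$, the assertion $S_k=\int_{\mathbb{R}}x^k\,d\mu$ for negative $k$ includes that $\mu(\{0\})$ is the zero matrix. *)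

theory Defs
  imports "HOL-Analysis.Analysis" "Jordan_Normal_Form.Matrix"
begin

definition symmetric_mats :: "nat \<Rightarrow> real mat set" where
  "symmetric_mats n = {A \<in> carrier_mat n n. transpose_mat A = A}"

definition positive_semidefinite :: "nat \<Rightarrow> real mat \<Rightarrow> bool" where
  "positive_semidefinite n A \<longleftrightarrow>
     A \<in> symmetric_mats n \<and> (\<forall>v \<in> carrier_vec n. 0 \<le> scalar_prod v (A *\<^sub>v v))"

definition positive_definite :: "nat \<Rightarrow> real mat \<Rightarrow> bool" where
  "positive_definite n A \<longleftrightarrow>
     A \<in> symmetric_mats n \<and>
     (\<forall>v \<in> carrier_vec n. v \<noteq> 0\<^sub>v n \<longrightarrow> 0 < scalar_prod v (A *\<^sub>v v))"

text \<open>
  The \<open>N \<times> N\<close> block matrix with \<open>p \<times> p\<close> blocks \<open>B i j\<close>, as a matrix of size \<open>N * p\<close>.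
  Blocks are numbered from 1 to \<open>N\<close>, whereas matrix entries are numbered from 0.
\<close>
definition block_matrix :: "nat \<Rightarrow> nat \<Rightarrow> (nat \<Rightarrow> nat \<Rightarrow> real mat) \<Rightarrow> real mat" where
  "block_matrix N p B =
     mat (N * p) (N * p) (\<lambda>(r, c). B (r div p + 1) (c div p + 1) $$ (r mod p, c mod p))"

text \<open>
  Set functions are total; only their values on \<open>sets M\<close> matter.
\<close>
definition signed_measure :: "'a measure \<Rightarrow> ('a set \<Rightarrow> real) \<Rightarrow> bool" where
  "signed_measure M m \<longleftrightarrow>
     m {} = 0 \<and>
     (\<forall>A :: nat \<Rightarrow> 'a set. range A \<subseteq> sets M \<longrightarrow> disjoint_family A \<longrightarrow>
        (\<lambda>n. m (A n)) sums m (\<Union>n. A n))"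

text \<open>
  The positive part \<open>A \<mapsto> sup {m B | B \<subseteq> A}\<close> of the Jordan decomposition of a signed measure.
  Since \<open>m {} = 0\<close>, truncating negative values by \<open>ennreal\<close> does not affect the supremum.
  The negative part is the positive part of \<open>- m\<close>.
\<close>
definition positive_variation :: "'a measure \<Rightarrow> ('a set \<Rightarrow> real) \<Rightarrow> 'a measure" where
  "positive_variation M m =
     measure_of (space M) (sets M) (\<lambda>A. SUP B \<in> {B \<in> sets M. B \<subseteq> A}. ennreal (m B))"

definition signed_integral :: "'a measure \<Rightarrow> ('a set \<Rightarrow> real) \<Rightarrow> ('a \<Rightarrow> real) \<Rightarrow> real" where
  "signed_integral M m f =
     (LINT x|positive_variation M m. f x) - (LINT x|positive_variation M (\<lambda>A. - m A). f x)"

definition positive_matrix_measure :: "nat \<Rightarrow> (real set \<Rightarrow> real mat) \<Rightarrow> bool" where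
  "positive_matrix_measure p \<mu> \<longleftrightarrow>
     (\<forall>\<Delta> \<in> sets borel. positive_semidefinite p (\<mu> \<Delta>)) \<and>
     (\<forall>i < p. \<forall>j < p. signed_measure borel (\<lambda>\<Delta>. \<mu> \<Delta> $$ (i, j)))"

definition trace_measure :: "nat \<Rightarrow> (real set \<Rightarrow> real mat) \<Rightarrow> real measure" where
  "trace_measure p \<mu> =
     measure_of UNIV (sets borel) (\<lambda>\<Delta>. ennreal (\<Sum>i<p. \<mu> \<Delta> $$ (i, i)))"

definition matrix_integral :: "nat \<Rightarrow> (real set \<Rightarrow> real mat) \<Rightarrow> (real \<Rightarrow> real) \<Rightarrow> real mat" where
  "matrix_integral p \<mu> f =
     mat p p (\<lambda>(i, j). signed_integral borel (\<lambda>\<Delta>. \<mu> \<Delta> $$ (i, j)) f)"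

text \<open>
  \<open>A = \<integral> x\<^sup>k d\<mu>\<close>. Here \<open>0 powi k = 0\<close> for \<open>k < 0\<close>, so that an atom at 0, where \<open>x\<^sup>k\<close> is
  undefined, has to be excluded explicitly.
\<close>
definition has_matrix_moment ::
    "nat \<Rightarrow> (real set \<Rightarrow> real mat) \<Rightarrow> int \<Rightarrow> real mat \<Rightarrow> bool" where
  "has_matrix_moment p \<mu> k A \<longleftrightarrow>
     (k < 0 \<longrightarrow> \<mu> {0} = 0\<^sub>m p p) \<and>
     integrable (trace_measure p \<mu>) (\<lambda>x. x powi k) \<and>
     A = matrix_integral p \<mu> (\<lambda>x. x powi k)"

end

theory Submission
  imports Defs
begin

text \<open>
  Put \<open>N = n1 + n2\<close> and \<open>T m = S (m - 2 * n1)\<close> for \<open>m \<le> 2 * N\<close>. If a matrix measure \<open>\<nu>\<close> has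
  the moments \<open>T m = \<integral> x^m d\<nu>\<close> and no mass at 0, then \<open>d\<mu> = x^(2 * n1) d\<nu>\<close> has the moments \<open>S k\<close>.
  So the statement is the truncated Hamburger moment problem for the positive definite block Hankel
  form \<open>H = (T (m + l))\<close>, with the additional demand that the solution avoid the point 0.

  The solution is a matrix Gauss quadrature. Let \<open>G = (T (m + l + 1))\<close> be the shifted Hankel form; its
  last corner involves one more moment \<open>T (2 * N + 1)\<close>, which is a free parameter. Since \<open>H\<close> is
  positive definite, \<open>H\<close> and \<open>G\<close> can be diagonalised simultaneously:
  \<open>H = \<Sum> c\<^sub>i c\<^sub>i\<^sup>T\<close> and \<open>G = \<Sum> x\<^sub>i c\<^sub>i c\<^sub>i\<^sup>T\<close> with linearly independent \<open>c\<^sub>i\<close>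
  (lemma \<open>simultaneous_diagonalization\<close>). For \<open>m < N\<close> the row \<open>(m, a)\<close> of \<open>G\<close> is the row \<open>(m + 1, a)\<close> of
  \<open>H\<close>, and comparing coefficients gives \<open>c\<^sub>i (m + 1, a) = x\<^sub>i * c\<^sub>i (m, a)\<close>. Hence
  \<open>c\<^sub>i (m, a) = x\<^sub>i^m * c\<^sub>i (0, a)\<close>, and the decomposition of \<open>H\<close> reads
  \<open>T k = \<Sum> x\<^sub>i^k w\<^sub>i w\<^sub>i\<^sup>T\<close> with \<open>w\<^sub>i = c\<^sub>i (0, _)\<close>: a finitely atomic measure with atoms \<open>x\<^sub>i\<close>.

  The atoms are nonzero exactly when \<open>G\<close> is nonsingular. This is arranged by taking \<open>t\<close> times the
  identity for the free moment. If \<open>v \<noteq> 0\<close> is in the kernel for the parameter \<open>t\<close>, then its last block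
  does not vanish, because otherwise \<open>H\<close> would annihilate the shift of \<open>v\<close>; and for different
  values of \<open>t\<close> these last blocks are orthogonal. So only finitely many \<open>t\<close> are bad (lemma
  \<open>nonsingular_shifted_hankel\<close>).

  What remains is to evaluate the integral against a finitely atomic signed measure through its Jordan
  decomposition (lemma \<open>signed_integral_atomic\<close>).

  The block index \<open>(m, a)\<close> ranges over \<open>{..N} \<times> {..<p}\<close>, whose size is not fixed by a type. Vectors
  and matrices are therefore real functions restricted to a finite index set. This also makes it
  possible to do linear algebra by induction on the index set, deleting one index at a time.
\<close>

section \<open>Symmetric forms on a finite index set\<close>

definition dot :: "'i set \<Rightarrow> ('i \<Rightarrow> real) \<Rightarrow> ('i \<Rightarrow> real) \<Rightarrow> real" where
  "dot I u v = (\<Sum>i\<in>I. u i * v i)"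

definition mat_vec :: "'i set \<Rightarrow> ('i \<Rightarrow> 'i \<Rightarrow> real) \<Rightarrow> ('i \<Rightarrow> real) \<Rightarrow> 'i \<Rightarrow> real" where
  "mat_vec I K v r = (\<Sum>s\<in>I. K r s * v s)"

definition symmetric_on :: "'i set \<Rightarrow> ('i \<Rightarrow> 'i \<Rightarrow> real) \<Rightarrow> bool" where
  "symmetric_on I K \<longleftrightarrow> (\<forall>r\<in>I. \<forall>s\<in>I. K r s = K s r)"

definition pos_def_on :: "'i set \<Rightarrow> ('i \<Rightarrow> 'i \<Rightarrow> real) \<Rightarrow> bool" where
  "pos_def_on I K \<longleftrightarrow> (\<forall>v. (\<exists>i\<in>I. v i \<noteq> 0) \<longrightarrow> 0 < dot I v (mat_vec I K v))"

lemma dot_commute: "dot I u v = dot I v u"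
  by (simp add: dot_def mult.commute)

lemma dot_linear_right:
  "dot I u (\<lambda>r. a * v r + b * w r) = a * dot I u v + b * dot I u w"
  by (simp add: dot_def sum.distrib sum_distrib_left algebra_simps)

lemma dot_linear_left:
  "dot I (\<lambda>r. a * v r + b * w r) u = a * dot I v u + b * dot I w u"
  by (simp add: dot_def sum.distrib sum_distrib_left algebra_simps)

lemma dot_self_pos:
  assumes "finite I" and "\<exists>i\<in>I. u i \<noteq> 0"
  shows "0 < dot I u u"
proof -
  obtain i where "i \<in> I" "u i \<noteq> 0" using assms(2) by blast
  then show ?thesis
    unfolding dot_def using assms(1)
    by (intro sum_pos2[of I i]) (auto simp: zero_less_mult_iff linorder_neq_iff)
qed

lemma dot_unit_left: "finite I \<Longrightarrow> q \<in> I \<Longrightarrow> dot I (\<lambda>i. of_bool (i = q)) u = u q"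
  by (simp add: dot_def sum.remove[of I q])

lemma mat_vec_linear:
  "mat_vec I K (\<lambda>r. a * v r + b * w r) = (\<lambda>r. a * mat_vec I K v r + b * mat_vec I K w r)"
  by (rule ext) (simp add: mat_vec_def sum.distrib sum_distrib_left algebra_simps)

lemma mat_vec_pencil:
  "mat_vec I (\<lambda>r s. G r s - l * H r s) v r = mat_vec I G v r - l * mat_vec I H v r"
  by (simp add: mat_vec_def sum_subtractf sum_distrib_left algebra_simps)

lemma mat_vec_self_adjoint:
  assumes "symmetric_on I K"
  shows "dot I u (mat_vec I K v) = dot I v (mat_vec I K u)"
proof -
  have "dot I u (mat_vec I K v) = (\<Sum>r\<in>I. \<Sum>s\<in>I. u r * K r s * v s)"
    by (simp add: dot_def mat_vec_def sum_distrib_left mult.assoc)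
  also have "\<dots> = (\<Sum>s\<in>I. \<Sum>r\<in>I. u r * K r s * v s)"
    by (rule sum.swap)
  also have "\<dots> = (\<Sum>s\<in>I. \<Sum>r\<in>I. v s * K s r * u r)"
    using assms by (intro sum.cong refl) (auto simp: symmetric_on_def)
  also have "\<dots> = dot I v (mat_vec I K u)"
    by (simp add: dot_def mat_vec_def sum_distrib_left mult.assoc)
  finally show ?thesis .
qed

lemma dot_mat_vec_add:
  assumes "symmetric_on I K"
  shows "dot I (\<lambda>r. a * u r + b * v r) (mat_vec I K (\<lambda>r. a * u r + b * v r)) =
    a\<^sup>2 * dot I u (mat_vec I K u) + 2 * a * b * dot I u (mat_vec I K v) + b\<^sup>2 * dot I v (mat_vec I K v)"
  using mat_vec_self_adjoint[OF assms, of v u]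
  by (simp add: mat_vec_linear dot_linear_left dot_linear_right power2_eq_square algebra_simps)

text \<open>
  Vectors are normalised to vanish outside \<open>I\<close>: in the product topology on all functions the set
  would not be compact if the coordinates outside \<open>I\<close> were free.
\<close>
lemma compact_unit_sphere:
  assumes "finite (I :: 'i set)"
  shows "compact {w :: 'i \<Rightarrow> real. (\<forall>i. i \<notin> I \<longrightarrow> w i = 0) \<and> dot I w w = 1}"
proof -
  let ?B = "PiE UNIV (\<lambda>i. if i \<in> I then {-1..1::real} else {0})"
  have "compactin (product_topology (\<lambda>i::'i. euclidean) UNIV) ?B"
    by (subst compactin_PiE) (auto simp: compactin_euclidean_iff)
  then have "compact ?B"
    by (simp add: euclidean_product_topology flip: compactin_euclidean_iff)
  moreover have "closed {w :: 'i \<Rightarrow> real. dot I w w = 1}"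
    unfolding dot_def by (intro closed_Collect_eq continuous_intros) auto
  moreover have "{w. (\<forall>i. i \<notin> I \<longrightarrow> w i = 0) \<and> dot I w w = 1} = ?B \<inter> {w. dot I w w = 1}"
  proof -
    have "w i \<in> (if i \<in> I then {-1..1} else {0}) \<longleftrightarrow> (i \<notin> I \<longrightarrow> w i = 0)" if "dot I w w = 1" for w i
    proof (cases "i \<in> I")
      case True
      have "w i * w i \<le> dot I w w"
        unfolding dot_def using assms True by (intro member_le_sum) auto
      then have "\<bar>w i\<bar> \<le> 1"
        using that by (simp add: power2_eq_square flip: abs_square_le_1)
      then show ?thesis using True by (simp add: abs_le_iff)
    qed simp
    then show ?thesis by (auto simp: PiE_UNIV_domain)
  qed
  ultimately show ?thesis by (simp add: compact_Int_closed)
qed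

text \<open>
  The quotient of the two quadratic forms attains its minimum \<open>l\<close> on the unit sphere, and it is
  invariant under scaling.
\<close>
lemma rayleigh_minimum:
  assumes fin: "finite (I :: 'i set)" and ne: "I \<noteq> {}" and H: "pos_def_on I H"
  obtains v l where "\<exists>i\<in>I. v i \<noteq> 0" "dot I v (mat_vec I G v) = l * dot I v (mat_vec I H v)"
    "\<And>w. l * dot I w (mat_vec I H w) \<le> dot I w (mat_vec I G w)"
proof -
  let ?S = "{w :: 'i \<Rightarrow> real. (\<forall>i. i \<notin> I \<longrightarrow> w i = 0) \<and> dot I w w = 1}"
  let ?f = "\<lambda>w. dot I w (mat_vec I G w) / dot I w (mat_vec I H w)"
  have nz: "\<exists>i\<in>I. w i \<noteq> 0" if "dot I w w = 1" for w
  proof (rule ccontr)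
    assume "\<not> ?thesis"
    then have "dot I w w = 0" by (simp add: dot_def)
    then show False using that by simp
  qed
  have pos: "dot I w (mat_vec I H w) > 0" if "dot I w w = 1" for w
    using H nz[OF that] by (auto simp: pos_def_on_def)
  obtain q where q: "q \<in> I" using ne by auto
  have "(\<lambda>i. of_bool (i = q)) \<in> ?S"
    using q fin by (auto simp: dot_unit_left)
  then have ne_S: "?S \<noteq> {}"
    unfolding ex_in_conv[symmetric] by (rule exI[where x = "\<lambda>i. of_bool (i = q)"])
  have cont: "continuous_on ?S (\<lambda>w. dot I w (mat_vec I K w))" for K
  proof (rule continuous_on_subset)
    show "continuous_on UNIV (\<lambda>w :: 'i \<Rightarrow> real. dot I w (mat_vec I K w))"
      unfolding dot_def mat_vec_def by (intro continuous_intros) auto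
  qed simp
  have "continuous_on ?S ?f"
  proof (rule continuous_on_divide)
    show "\<forall>w\<in>?S. dot I w (mat_vec I H w) \<noteq> 0" using pos by force
  qed (rule cont)+
  then obtain v where v: "v \<in> ?S" "\<And>w. w \<in> ?S \<Longrightarrow> ?f v \<le> ?f w"
    using continuous_attains_inf[OF compact_unit_sphere[OF fin] ne_S, of ?f] by blast
  show ?thesis
  proof (rule that[of v "?f v"])
    show "\<exists>i\<in>I. v i \<noteq> 0" using v nz by auto
    show "dot I v (mat_vec I G v) = ?f v * dot I v (mat_vec I H v)"
      using v pos[of v] by simp
    fix w
    show "?f v * dot I w (mat_vec I H w) \<le> dot I w (mat_vec I G w)"
    proof (cases "\<exists>i\<in>I. w i \<noteq> 0")
      case False
      then have "dot I w u = 0" for u by (simp add: dot_def)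
      then show ?thesis by simp
    next
      case True
      define n where "n = sqrt (dot I w w)"
      have "dot I w w > 0"
        using fin True by (rule dot_self_pos)
      then have n: "n > 0" "n\<^sup>2 = dot I w w" by (simp_all add: n_def)
      define u where "u = (\<lambda>i. if i \<in> I then w i / n else 0)"
      have scale: "dot I u (mat_vec I K u) = dot I w (mat_vec I K w) / n\<^sup>2" for K
        by (simp add: dot_def mat_vec_def u_def power2_eq_square sum_divide_distrib sum_distrib_left)
      have "dot I u u = dot I w w / n\<^sup>2"
        by (simp add: dot_def u_def power2_eq_square sum_divide_distrib)
      then have "dot I u u = 1" unfolding n(2)[symmetric] using n(1) by simp
      then have u: "u \<in> ?S" by (auto simp: u_def)
      have "?f v \<le> ?f u" by (rule v(2)[OF u])
      then have "?f v * dot I u (mat_vec I H u) \<le> dot I u (mat_vec I G u)"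
        using pos[of u] u by (simp add: pos_le_divide_eq)
      then have "?f v * dot I w (mat_vec I H w) / n\<^sup>2 \<le> dot I w (mat_vec I G w) / n\<^sup>2"
        unfolding scale times_divide_eq_right .
      then show ?thesis
        unfolding divide_le_cancel using n(1) by simp
    qed
  qed
qed

text \<open>
  The form is nonnegative on the line \<open>v + b * e\<close> through the null vector \<open>v\<close>, for the unit vector
  \<open>e\<close> at \<open>r\<close>. There it is a quadratic polynomial in \<open>b\<close> without constant term, so its linear
  coefficient, twice the entry in question, must be 0.
\<close>
lemma psd_null_vector_in_kernel:
  assumes fin: "finite I" and sym: "symmetric_on I K" and psd: "\<And>w. 0 \<le> dot I w (mat_vec I K w)"
    and null: "dot I v (mat_vec I K v) = 0" and r: "r \<in> I"
  shows "mat_vec I K v r = 0"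
proof (rule ccontr)
  assume nz: "mat_vec I K v r \<noteq> 0"
  define e where "e = (\<lambda>i. of_bool (i = r) :: real)"
  have e: "dot I e (mat_vec I K v) = mat_vec I K v r"
    using fin r by (simp add: e_def dot_unit_left)
  let ?a = "mat_vec I K v r" and ?k = "dot I e (mat_vec I K e)"
  have q: "0 \<le> 2 * b * ?a + b\<^sup>2 * ?k" for b
    using psd[of "\<lambda>i. 1 * v i + b * e i"] mat_vec_self_adjoint[OF sym, of v e] null e
    unfolding dot_mat_vec_add[OF sym] by simp
  have k: "0 \<le> ?k" by (rule psd)
  \<comment> \<open>A point where the quadratic \<open>2 * b * ?a + b\<^sup>2 * ?k\<close> is negative; the summand 1 covers \<open>?k = 0\<close>.\<close>
  define b where "b = - ?a / (?k + 1)"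
  have a: "?a = - b * (?k + 1)" and b: "b \<noteq> 0"
    using k nz by (simp_all add: b_def)
  have "2 * b * ?a + b\<^sup>2 * ?k = - (b\<^sup>2 * (?k + 2))"
    by (subst a) (simp add: power2_eq_square algebra_simps)
  also have "\<dots> < 0" using k b by (simp add: mult_pos_pos)
  finally show False using q[of b] by simp
qed

text \<open>
  At a minimiser of the Rayleigh quotient the form \<open>G - l * H\<close> is positive semidefinite and
  vanishes, so the minimiser lies in its kernel.
\<close>
lemma pencil_eigenvector:
  assumes fin: "finite I" and ne: "I \<noteq> {}" and H: "pos_def_on I H"
    and sym: "symmetric_on I H" "symmetric_on I G"
  obtains v l where "\<exists>i\<in>I. v i \<noteq> 0" "dot I v (mat_vec I H v) = 1"
    "\<And>r. r \<in> I \<Longrightarrow> mat_vec I G v r = l * mat_vec I H v r"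
proof -
  obtain v l where v: "\<exists>i\<in>I. v i \<noteq> 0" "dot I v (mat_vec I G v) = l * dot I v (mat_vec I H v)"
    "\<And>w. l * dot I w (mat_vec I H w) \<le> dot I w (mat_vec I G w)"
    using rayleigh_minimum[OF fin ne H] by metis
  let ?K = "\<lambda>r s. G r s - l * H r s"
  have K: "dot I w (mat_vec I ?K w) = dot I w (mat_vec I G w) - l * dot I w (mat_vec I H w)" for w
    using dot_linear_right[of I w 1 "mat_vec I G w" "- l" "mat_vec I H w"] by (simp add: mat_vec_pencil[abs_def])
  have "mat_vec I ?K v r = 0" if "r \<in> I" for r
    using sym v that by (intro psd_null_vector_in_kernel fin) (auto simp: K symmetric_on_def)
  then have eig: "mat_vec I G v r = l * mat_vec I H v r" if "r \<in> I" for r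
    using that by (simp add: mat_vec_pencil)
  define n where "n = sqrt (dot I v (mat_vec I H v))"
  have "dot I v (mat_vec I H v) > 0" using v H by (auto simp: pos_def_on_def)
  then have n: "n > 0" "n\<^sup>2 = dot I v (mat_vec I H v)" by (simp_all add: n_def)
  define u where "u = (\<lambda>i. (1/n) * v i + 0 * v i)"
  have u: "mat_vec I K u = (\<lambda>r. (1/n) * mat_vec I K v r + 0 * mat_vec I K v r)" for K
    unfolding u_def by (rule mat_vec_linear)
  show ?thesis
  proof (rule that[of u l])
    show "\<exists>i\<in>I. u i \<noteq> 0" using v n by (auto simp: u_def)
    have "dot I u (mat_vec I H u) = (1/n)\<^sup>2 * dot I v (mat_vec I H v)"
      unfolding u_def using dot_mat_vec_add[OF sym(1), of "1/n" v 0 v] by simp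
    also have "\<dots> = 1" using n by (simp add: power_divide flip: n(2))
    finally show "dot I u (mat_vec I H u) = 1" .
  qed (simp add: u eig)
qed

text \<open>
  A kernel vector that does not vanish at \<open>q\<close> expresses row and column \<open>q\<close> by the other ones. This is
  what allows an identity of symmetric forms to be lifted from \<open>I - {q}\<close> to \<open>I\<close>.
\<close>
lemma symmetric_eq_0_by_kernel_vector:
  assumes fin: "finite I" and q: "q \<in> I" and vq: "v q \<noteq> 0" and sym: "symmetric_on I D"
    and minor: "\<And>r s. r \<in> I - {q} \<Longrightarrow> s \<in> I - {q} \<Longrightarrow> D r s = 0"
    and ker: "\<And>r. r \<in> I \<Longrightarrow> mat_vec I D v r = 0" and rs: "r \<in> I" "s \<in> I"
  shows "D r s = 0"
proof -
  have split: "mat_vec I D v r = D r q * v q + (\<Sum>s\<in>I - {q}. D r s * v s)" for r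
    unfolding mat_vec_def using fin q by (simp add: sum.remove)
  have col: "D r q = 0" if "r \<in> I - {q}" for r
    using split[of r] ker[of r] that vq minor by simp
  have row: "D q s = 0" if "s \<in> I - {q}" for s
    using col[OF that] sym q that by (auto simp: symmetric_on_def)
  have "D q q = 0"
    using split[of q] ker[of q] q vq row by simp
  then show ?thesis using col row minor rs by (cases "r = q"; cases "s = q") auto
qed

text \<open>
  Induction by deflation. For an eigenvector \<open>v0\<close> of the pencil with \<open>v0\<^sup>T H v0 = 1\<close> and
  \<open>c0 = H v0\<close>, the forms \<open>H - c0 c0\<^sup>T\<close> and \<open>G - l0 * c0 c0\<^sup>T\<close> both annihilate \<open>v0\<close>. Deleting an index
  \<open>q\<close> at which \<open>v0\<close> does not vanish keeps the first one positive definite, so the induction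
  hypothesis applies; afterwards its vectors are extended to \<open>q\<close> by the condition of being
  orthogonal to \<open>v0\<close>.

  The dual vectors \<open>v i\<close> record that the \<open>c i\<close> are linearly independent. They also are the
  eigenvectors of the pencil: \<open>H (v i) = c i\<close> and \<open>G (v i) = l i * c i\<close>.
\<close>
lemma simultaneous_diagonalization:
  assumes "finite I" "pos_def_on I H" "symmetric_on I H" "symmetric_on I G"
  shows "\<exists>l c v. (\<forall>i\<in>I. \<forall>j\<in>I. dot I (v i) (c j) = of_bool (i = j)) \<and>
    (\<forall>r\<in>I. \<forall>s\<in>I. H r s = (\<Sum>i\<in>I. c i r * c i s)) \<and>
    (\<forall>r\<in>I. \<forall>s\<in>I. G r s = (\<Sum>i\<in>I. l i * c i r * c i s))"
  using assms
proof (induction "card I" arbitrary: I H G)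
  case 0
  then show ?case by simp
next
  case (Suc n)
  note fin = Suc.prems(1) and symH = Suc.prems(3) and symG = Suc.prems(4)
  have "I \<noteq> {}" using Suc by auto
  then obtain v0 l0 where v0: "\<exists>i\<in>I. v0 i \<noteq> 0" "dot I v0 (mat_vec I H v0) = 1"
    "\<And>r. r \<in> I \<Longrightarrow> mat_vec I G v0 r = l0 * mat_vec I H v0 r"
    using pencil_eigenvector[OF fin _ Suc.prems(2-4)] by metis
  then obtain q where q: "q \<in> I" "v0 q \<noteq> 0" by auto
  define J where "J = I - {q}"
  have IJ: "I = insert q J" "q \<notin> J" "finite J" using q fin by (auto simp: J_def)
  define c0 where "c0 = mat_vec I H v0"
  define H1 where "H1 = (\<lambda>r s. H r s - c0 r * c0 s)"
  define G1 where "G1 = (\<lambda>r s. G r s - l0 * c0 r * c0 s)"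
  have sym1: "symmetric_on I H1" "symmetric_on I G1"
    using symH symG by (auto simp: H1_def G1_def symmetric_on_def)
  have mat_vec_H1: "mat_vec I H1 w r = mat_vec I H w r - c0 r * dot I c0 w" for w r
    by (simp add: H1_def mat_vec_def dot_def sum_subtractf sum_distrib_left algebra_simps)
  have mat_vec_G1: "mat_vec I G1 w r = mat_vec I G w r - l0 * c0 r * dot I c0 w" for w r
    by (simp add: G1_def mat_vec_def dot_def sum_subtractf sum_distrib_left algebra_simps)
  have c0v0: "dot I c0 v0 = 1" using v0(2) by (simp add: c0_def dot_commute)
  have ker1: "mat_vec I H1 v0 r = 0" "mat_vec I G1 v0 r = 0" if "r \<in> I" for r
    using v0(3)[OF that] c0v0 by (simp_all add: mat_vec_H1 mat_vec_G1 c0_def)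
  \<comment> \<open>The value of \<open>H1\<close> at \<open>w\<close> is that of \<open>H\<close> at the component of \<open>w\<close> that is \<open>H\<close>-orthogonal to
      \<open>v0\<close>; it is not 0, because \<open>w\<close> vanishes at \<open>q\<close> and \<open>v0\<close> does not.\<close>
  have "pos_def_on J H1"
    unfolding pos_def_on_def
  proof (intro allI impI)
    fix w0 :: "'a \<Rightarrow> real" assume w0: "\<exists>i\<in>J. w0 i \<noteq> 0"
    define w where "w = w0(q := 0)"
    have w: "\<exists>i\<in>J. w i \<noteq> 0" "w q = 0" using w0 IJ by (auto simp: w_def)
    define a where "a = dot I c0 w"
    define u where "u = (\<lambda>r. 1 * w r + (- a) * v0 r)"
    have "\<exists>i\<in>I. u i \<noteq> 0"
    proof (rule ccontr)
      assume "\<not> ?thesis"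
      then have z: "\<And>i. i \<in> I \<Longrightarrow> u i = 0" by auto
      have "a = 0" using z[OF q(1)] q w by (simp add: u_def)
      then show False using z w IJ by (auto simp: u_def)
    qed
    then have "0 < dot I u (mat_vec I H u)" using Suc.prems(2) by (auto simp: pos_def_on_def)
    also have "\<dots> = dot I w (mat_vec I H w) - 2 * a * dot I w c0 + a\<^sup>2"
      unfolding u_def dot_mat_vec_add[OF symH] using v0(2) by (simp add: c0_def)
    also have "dot I w c0 = a" by (simp add: a_def dot_commute)
    also have "dot I w (mat_vec I H w) - 2 * a * a + a\<^sup>2 = dot I w (mat_vec I H w) - a * dot I w c0"
      by (simp add: a_def dot_commute power2_eq_square)
    also have "\<dots> = dot I w (mat_vec I H1 w)"
      using dot_linear_right[of I w 1 "mat_vec I H w" "-a" c0]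
      by (simp add: mat_vec_H1[abs_def] a_def mult.commute)
    also have "\<dots> = dot J w (mat_vec J H1 w)"
      using IJ w by (simp add: dot_def mat_vec_def)
    also have "\<dots> = dot J w0 (mat_vec J H1 w0)"
      unfolding dot_def mat_vec_def using IJ(2) by (intro sum.cong arg_cong2[of _ _ _ _ "(*)"]) (auto simp: w_def)
    finally show "0 < dot J w0 (mat_vec J H1 w0)" .
  qed
  moreover have "symmetric_on J H1" "symmetric_on J G1"
    using sym1 IJ by (auto simp: symmetric_on_def)
  moreover have "n = card J" using Suc.hyps(2) IJ by simp
  ultimately have "\<exists>l c v. (\<forall>i\<in>J. \<forall>j\<in>J. dot J (v i) (c j) = of_bool (i = j)) \<and>
      (\<forall>r\<in>J. \<forall>s\<in>J. H1 r s = (\<Sum>i\<in>J. c i r * c i s)) \<and>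
      (\<forall>r\<in>J. \<forall>s\<in>J. G1 r s = (\<Sum>i\<in>J. l i * c i r * c i s))"
    using IJ(3) by (intro Suc.hyps(1))
  then obtain l c v where
    dual: "\<And>i j. i \<in> J \<Longrightarrow> j \<in> J \<Longrightarrow> dot J (v i) (c j) = of_bool (i = j)" and
    decH: "\<And>r s. r \<in> J \<Longrightarrow> s \<in> J \<Longrightarrow> H1 r s = (\<Sum>i\<in>J. c i r * c i s)" and
    decG: "\<And>r s. r \<in> J \<Longrightarrow> s \<in> J \<Longrightarrow> G1 r s = (\<Sum>i\<in>J. l i * c i r * c i s)"
    by blast
  \<comment> \<open>\<open>c1\<close> is made orthogonal to \<open>v0\<close> by its entry at \<open>q\<close>, and \<open>v1\<close> orthogonal to \<open>c0\<close> by
      subtracting a multiple of \<open>v0\<close>, which does not change its products with the \<open>c1\<close>.\<close>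
  define c1 where "c1 = (\<lambda>i. (c i)(q := - dot J (c i) v0 / v0 q))"
  define v1 where "v1 = (\<lambda>i r. 1 * ((v i)(q := 0)) r + (- dot I c0 ((v i)(q := 0))) * v0 r)"
  define L where "L = l(q := l0)"
  define C where "C = c1(q := c0)"
  define V where "V = v1(q := v0)"
  have c1v0: "dot I (c1 i) v0 = 0" for i
  proof -
    have "dot I (c1 i) v0 = (- dot J (c i) v0 / v0 q) * v0 q + (\<Sum>r\<in>J. c1 i r * v0 r)"
      using IJ by (simp add: dot_def c1_def)
    also have "(\<Sum>r\<in>J. c1 i r * v0 r) = dot J (c i) v0"
      unfolding dot_def using IJ(2) by (intro sum.cong) (auto simp: c1_def)
    finally show ?thesis using q by simp
  qed
  have dual1: "dot I (v1 i) (c1 j) = of_bool (i = j)" if "i \<in> J" "j \<in> J" for i j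
  proof -
    have "dot I (v1 i) (c1 j) = dot I ((v i)(q := 0)) (c1 j)"
      unfolding v1_def dot_linear_left using c1v0[of j] by (simp add: dot_commute fun_upd_def)
    also have "\<dots> = dot J (v i) (c j)"
      unfolding dot_def IJ(1) using IJ(2,3) by (simp add: c1_def, intro sum.cong) auto
    finally show ?thesis using dual that by simp
  qed
  have dual2: "dot I (v1 i) c0 = 0" for i
    unfolding v1_def dot_linear_left using c0v0 by (simp add: dot_commute fun_upd_def)
  have dualV: "dot I (V i) (C j) = of_bool (i = j)" if "i \<in> I" "j \<in> I" for i j
    using that dual1[of i j] dual2[of i] c1v0[of j] c0v0 IJ
    by (auto simp: V_def C_def dot_commute)
  have dec: "K r s = (\<Sum>i\<in>J. m i * c1 i r * c1 i s)"
    if sym: "symmetric_on I K" and ker: "\<And>r. r \<in> I \<Longrightarrow> mat_vec I K v0 r = 0"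
      and minor: "\<And>r s. r \<in> J \<Longrightarrow> s \<in> J \<Longrightarrow> K r s = (\<Sum>i\<in>J. m i * c i r * c i s)"
      and rs: "r \<in> I" "s \<in> I" for K m r s
  proof -
    let ?D = "\<lambda>r s. K r s - (\<Sum>i\<in>J. m i * c1 i r * c1 i s)"
    have kerD: "mat_vec I ?D v0 r = 0" if "r \<in> I" for r
    proof -
      have "(\<Sum>s\<in>I. (\<Sum>i\<in>J. m i * c1 i r * c1 i s) * v0 s) = (\<Sum>s\<in>I. \<Sum>i\<in>J. m i * c1 i r * (c1 i s * v0 s))"
        by (simp add: sum_distrib_right mult.assoc)
      also have "\<dots> = (\<Sum>i\<in>J. \<Sum>s\<in>I. m i * c1 i r * (c1 i s * v0 s))"
        by (rule sum.swap)
      also have "\<dots> = (\<Sum>i\<in>J. m i * c1 i r * dot I (c1 i) v0)"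
        by (simp add: dot_def sum_distrib_left)
      finally have "(\<Sum>s\<in>I. (\<Sum>i\<in>J. m i * c1 i r * c1 i s) * v0 s) = 0"
        by (simp add: c1v0)
      moreover have "mat_vec I ?D v0 r = mat_vec I K v0 r - (\<Sum>s\<in>I. (\<Sum>i\<in>J. m i * c1 i r * c1 i s) * v0 s)"
        by (simp add: mat_vec_def left_diff_distrib sum_subtractf)
      ultimately show ?thesis using ker that by simp
    qed
    have "?D r s = 0"
    proof (rule symmetric_eq_0_by_kernel_vector[where D = ?D and v = v0, OF fin q])
      show "symmetric_on I ?D"
        using sym by (auto simp: symmetric_on_def mult.commute mult.left_commute)
      show "?D r s = 0" if "r \<in> I - {q}" "s \<in> I - {q}" for r s
        using minor[of r s] that by (simp add: J_def c1_def)
    qed (use kerD rs in auto)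
    then show ?thesis by simp
  qed
  have "H r s = (\<Sum>i\<in>I. C i r * C i s)" if "r \<in> I" "s \<in> I" for r s
  proof -
    have "H r s = c0 r * c0 s + (\<Sum>i\<in>J. c1 i r * c1 i s)"
      using dec[OF sym1(1) ker1(1), of "\<lambda>_. 1" r s] decH that by (simp add: H1_def)
    also have "(\<Sum>i\<in>J. c1 i r * c1 i s) = (\<Sum>i\<in>J. C i r * C i s)"
      using IJ(2) by (intro sum.cong) (auto simp: C_def)
    finally show ?thesis using IJ by (simp add: C_def)
  qed
  moreover have "G r s = (\<Sum>i\<in>I. L i * C i r * C i s)" if "r \<in> I" "s \<in> I" for r s
  proof -
    have "G r s = l0 * c0 r * c0 s + (\<Sum>i\<in>J. l i * c1 i r * c1 i s)"
      using dec[OF sym1(2) ker1(2), of l r s] decG that by (simp add: G1_def)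
    also have "(\<Sum>i\<in>J. l i * c1 i r * c1 i s) = (\<Sum>i\<in>J. L i * C i r * C i s)"
      using IJ(2) by (intro sum.cong) (auto simp: C_def L_def)
    finally show ?thesis using IJ by (simp add: C_def L_def)
  qed
  ultimately show ?case using dualV by blast
qed

section \<open>Orthogonal families\<close>

text \<open>
  A dimension bound by Bessel's inequality, which bounds for each coordinate \<open>r\<close> the sum \<open>S r\<close> of the
  squared entries of the normalised vectors by 1. Summing over \<open>r\<close> counts each vector once.
\<close>
lemma pairwise_orthogonal_card_le:
  assumes fin: "finite P" "finite F" and nz: "\<And>i. i \<in> F \<Longrightarrow> \<exists>b\<in>P. y i b \<noteq> 0"
    and orth: "\<And>i j. i \<in> F \<Longrightarrow> j \<in> F \<Longrightarrow> i \<noteq> j \<Longrightarrow> dot P (y i) (y j) = 0"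
  shows "card F \<le> card P"
proof -
  define n where "n = (\<lambda>i. dot P (y i) (y i))"
  have n: "n i > 0" if "i \<in> F" for i
    unfolding n_def using fin(1) nz[OF that] by (rule dot_self_pos)
  define S where "S = (\<lambda>r. \<Sum>i\<in>F. (y i r)\<^sup>2 / n i)"
  have S: "S r \<le> 1" if r: "r \<in> P" for r
  proof -
    \<comment> \<open>\<open>z\<close> is the projection of the unit vector at \<open>r\<close> to the span of the family.\<close>
    define q where "q = (\<lambda>i. y i r / n i)"
    define z where "z = (\<lambda>b. \<Sum>i\<in>F. q i * y i b)"
    have "dot P z z = (\<Sum>b\<in>P. \<Sum>i\<in>F. \<Sum>j\<in>F. q i * q j * (y i b * y j b))"
      unfolding dot_def z_def sum_product by (intro sum.cong refl) (simp only: mult_ac)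
    also have "\<dots> = (\<Sum>i\<in>F. \<Sum>b\<in>P. \<Sum>j\<in>F. q i * q j * (y i b * y j b))"
      by (rule sum.swap)
    also have "\<dots> = (\<Sum>i\<in>F. \<Sum>j\<in>F. \<Sum>b\<in>P. q i * q j * (y i b * y j b))"
      by (intro sum.cong refl sum.swap)
    also have "\<dots> = (\<Sum>i\<in>F. \<Sum>j\<in>F. q i * q j * dot P (y i) (y j))"
      by (simp add: dot_def sum_distrib_left)
    also have "\<dots> = (\<Sum>i\<in>F. \<Sum>j\<in>F. if j = i then (y i r)\<^sup>2 / n i else 0)"
    proof (intro sum.cong refl)
      fix i j assume ij: "i \<in> F" "j \<in> F"
      show "q i * q j * dot P (y i) (y j) = (if j = i then (y i r)\<^sup>2 / n i else 0)"
      proof (cases "j = i")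
        case True
        then have "q i * q j * dot P (y i) (y j) = q i * q i * n i" by (simp add: n_def)
        also have "\<dots> = (y i r)\<^sup>2 / n i"
          using n[OF ij(1)] by (simp add: q_def power2_eq_square)
        finally show ?thesis using True by simp
      qed (use orth ij in auto)
    qed
    also have "\<dots> = S r" using fin by (simp add: S_def)
    finally have zz: "dot P z z = S r" .
    have "z r = S r" by (simp add: z_def q_def S_def power2_eq_square)
    then have "S r * S r = z r * z r" by simp
    also have "\<dots> \<le> dot P z z" unfolding dot_def using fin r by (intro member_le_sum) auto
    finally have "S r * S r \<le> S r" by (simp add: zz)
    then show ?thesis
      using mult_strict_left_mono[of 1 "S r" "S r"] by (cases "S r \<le> 1") auto
  qed
  have one: "(\<Sum>r\<in>P. (y i r)\<^sup>2) / n i = 1" if "i \<in> F" for i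
    using n[OF that] by (simp add: n_def dot_def power2_eq_square)
  have "real (card F) = (\<Sum>i\<in>F. 1)"
    by simp
  also have "\<dots> = (\<Sum>i\<in>F. (\<Sum>r\<in>P. (y i r)\<^sup>2) / n i)"
    by (rule sum.cong[OF refl]) (rule one[symmetric])
  also have "\<dots> = (\<Sum>i\<in>F. \<Sum>r\<in>P. (y i r)\<^sup>2 / n i)"
    by (simp add: sum_divide_distrib)
  also have "\<dots> = (\<Sum>r\<in>P. S r)"
    unfolding S_def by (rule sum.swap)
  also have "\<dots> \<le> (\<Sum>r\<in>P. 1)" by (intro sum_mono S)
  finally show ?thesis by simp
qed

section \<open>Block Hankel forms and the truncated moment problem\<close>

definition hankel :: "(nat \<Rightarrow> 'b \<Rightarrow> 'b \<Rightarrow> real) \<Rightarrow> nat \<times> 'b \<Rightarrow> nat \<times> 'b \<Rightarrow> real" where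
  "hankel T r s = T (fst r + fst s) (snd r) (snd s)"

text \<open>
  The form \<open>(T (m + l + 1))\<close>. For block indices up to \<open>N\<close> the moment \<open>T (2 * N + 1)\<close> occurs only in
  the last diagonal block; it is replaced by \<open>t\<close> times the identity.
\<close>
definition shifted_hankel ::
    "nat \<Rightarrow> real \<Rightarrow> (nat \<Rightarrow> 'b \<Rightarrow> 'b \<Rightarrow> real) \<Rightarrow> nat \<times> 'b \<Rightarrow> nat \<times> 'b \<Rightarrow> real" where
  "shifted_hankel N t T =
     hankel (\<lambda>k. if k = 2 * N then (\<lambda>a b. t * of_bool (a = b)) else T (Suc k))"

lemma symmetric_on_hankel:
  assumes "\<And>k. k \<le> 2 * N \<Longrightarrow> symmetric_on P (T k)"
  shows "symmetric_on ({..N} \<times> P) (hankel T)"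
proof -
  have "T (m + l) a b = T (m + l) b a" if "m \<le> N" "l \<le> N" "a \<in> P" "b \<in> P" for m l a b
    using assms[of "m + l"] that by (auto simp: symmetric_on_def)
  then show ?thesis by (auto simp: symmetric_on_def hankel_def add.commute)
qed

lemma symmetric_on_shifted_hankel:
  assumes "\<And>k. k \<le> 2 * N \<Longrightarrow> symmetric_on P (T k)"
  shows "symmetric_on ({..N} \<times> P) (shifted_hankel N t T)"
  unfolding shifted_hankel_def
proof (rule symmetric_on_hankel)
  fix k assume "k \<le> 2 * N"
  then show "symmetric_on P (if k = 2 * N then (\<lambda>a b. t * of_bool (a = b)) else T (Suc k))"
    using assms[of "Suc k"] by (auto simp: symmetric_on_def)
qed

lemma mat_vec_hankel:
  "mat_vec ({..N} \<times> P) (hankel T) v (m, a) = (\<Sum>l\<le>N. \<Sum>b\<in>P. T (m + l) a b * v (l, b))"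
  by (simp add: mat_vec_def hankel_def sum.cartesian_product case_prod_unfold)

text \<open>
  If the last block of \<open>v\<close> vanishes, the parameter \<open>t\<close> does not enter, and the shifted form applied
  to \<open>v\<close> is the Hankel form applied to the vector \<open>w\<close> obtained by moving every block up by one.
  In terms of polynomials, \<open>w\<close> is \<open>x\<close> times \<open>v\<close>. So \<open>w\<close>, and with it \<open>v\<close>, is 0.
\<close>
lemma shifted_hankel_last_block_nonzero:
  assumes pd: "pos_def_on ({..N} \<times> P) (hankel T)"
    and ker: "\<And>r. r \<in> {..N} \<times> P \<Longrightarrow>
      mat_vec ({..N} \<times> P) (shifted_hankel N t T) v r = 0"
    and nz: "\<exists>r\<in>{..N} \<times> P. v r \<noteq> 0"
  shows "\<exists>b\<in>P. v (N, b) \<noteq> 0"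
proof (rule ccontr)
  assume "\<not> ?thesis"
  then have last: "\<And>b. b \<in> P \<Longrightarrow> v (N, b) = 0" by auto
  let ?I = "{..N} \<times> P"
  define w where "w = (\<lambda>(l, b). if l = 0 then 0 else v (l - 1, b))"
  have "mat_vec ?I (hankel T) w (m, a) = 0" if "m \<le> N" "a \<in> P" for m a
  proof -
    let ?T = "\<lambda>k. if k = 2 * N then (\<lambda>a b. t * of_bool (a = b)) else T (Suc k)"
    have "mat_vec ?I (hankel T) w (m, a) = (\<Sum>l<N. \<Sum>b\<in>P. T (m + Suc l) a b * v (l, b))"
      by (simp add: mat_vec_hankel sum.atMost_shift w_def)
    also have "\<dots> = (\<Sum>l<N. \<Sum>b\<in>P. ?T (m + l) a b * v (l, b))"
      using that by (intro sum.cong refl) auto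
    also have "\<dots> = mat_vec ?I (shifted_hankel N t T) v (m, a)"
      unfolding shifted_hankel_def mat_vec_hankel using last by (simp flip: lessThan_Suc_atMost)
    finally show ?thesis using ker that by simp
  qed
  then have "dot ?I w (mat_vec ?I (hankel T) w) = 0"
    by (auto simp: dot_def intro!: sum.neutral)
  then have w: "\<And>r. r \<in> ?I \<Longrightarrow> w r = 0"
    using pd unfolding pos_def_on_def by force
  obtain l b where lb: "l \<le> N" "b \<in> P" "v (l, b) \<noteq> 0" using nz by auto
  then have "l < N" using last[of b] by (cases "l = N") auto
  then show False using w[of "(Suc l, b)"] lb by (simp add: w_def)
qed

lemma shifted_hankel_bilinear:
  assumes fin: "finite P"
  shows "dot ({..N} \<times> P) u (mat_vec ({..N} \<times> P) (shifted_hankel N t T) v) =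
    dot ({..N} \<times> P) u (mat_vec ({..N} \<times> P) (shifted_hankel N 0 T) v) +
    t * dot P (\<lambda>b. u (N, b)) (\<lambda>b. v (N, b))"
proof -
  let ?I = "{..N} \<times> P"
  let ?G = "\<lambda>t. shifted_hankel N t T"
  have "mat_vec ?I (?G t) v r = mat_vec ?I (?G 0) v r + t * of_bool (fst r = N) * v r" if r: "r \<in> ?I" for r
  proof -
    have "?G t r s * v s = ?G 0 r s * v s + (if s = r then t * of_bool (fst r = N) * v r else 0)"
      if "s \<in> ?I" for s
      using r that by (cases r; cases s) (auto simp: shifted_hankel_def hankel_def)
    then have "mat_vec ?I (?G t) v r =
        (\<Sum>s\<in>?I. ?G 0 r s * v s + (if s = r then t * of_bool (fst r = N) * v r else 0))"
      unfolding mat_vec_def by (intro sum.cong refl) auto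
    then show ?thesis using r fin by (simp add: sum.distrib mat_vec_def)
  qed
  then have "dot ?I u (mat_vec ?I (?G t) v) =
      (\<Sum>r\<in>?I. u r * mat_vec ?I (?G 0) v r + t * (of_bool (fst r = N) * (u r * v r)))"
    unfolding dot_def by (intro sum.cong refl) (simp add: algebra_simps)
  also have "\<dots> = dot ?I u (mat_vec ?I (?G 0) v) + t * (\<Sum>r\<in>?I. of_bool (fst r = N) * (u r * v r))"
    by (simp add: sum.distrib dot_def sum_distrib_left)
  also have "(\<Sum>r\<in>?I. of_bool (fst r = N) * (u r * v r)) =
      (\<Sum>m\<le>N. \<Sum>b\<in>P. of_bool (m = N) * (u (m, b) * v (m, b)))"
    by (simp add: sum.cartesian_product case_prod_unfold)
  also have "\<dots> = dot P (\<lambda>b. u (N, b)) (\<lambda>b. v (N, b))"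
    by (simp add: dot_def flip: lessThan_Suc_atMost)
  finally show ?thesis .
qed

text \<open>
  Kernel vectors \<open>u\<close> and \<open>v\<close> for different parameters \<open>s\<close> and \<open>t\<close> satisfy
  \<open>u\<^sup>T G\<^sub>0 v = - t * (u\<^sub>N \<bullet> v\<^sub>N) = - s * (u\<^sub>N \<bullet> v\<^sub>N)\<close>, where \<open>G\<^sub>0\<close> is the form for the parameter
  0 and \<open>u\<^sub>N\<close>, \<open>v\<^sub>N\<close> are the last blocks. So their last blocks, which are not 0 for nonzero kernel vectors, are orthogonal, and \<open>card P + 1\<close>
  bad parameters would be too many.
\<close>
lemma nonsingular_shifted_hankel:
  assumes fin: "finite P" and pd: "pos_def_on ({..N} \<times> P) (hankel T)"
    and sym: "\<And>k. k \<le> 2 * N \<Longrightarrow> symmetric_on P (T k)"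
  obtains t where "\<And>v. (\<And>r. r \<in> {..N} \<times> P \<Longrightarrow>
      mat_vec ({..N} \<times> P) (shifted_hankel N t T) v r = 0) \<Longrightarrow>
    (\<And>r. r \<in> {..N} \<times> P \<Longrightarrow> v r = 0)"
proof -
  let ?I = "{..N} \<times> P"
  let ?G = "\<lambda>t. shifted_hankel N t T"
  have "\<exists>t. \<forall>v. (\<forall>r\<in>?I. mat_vec ?I (?G t) v r = 0) \<longrightarrow> (\<forall>r\<in>?I. v r = 0)"
  proof (rule ccontr)
    assume "\<not> ?thesis"
    then have "\<forall>t. \<exists>v. (\<forall>r\<in>?I. mat_vec ?I (?G t) v r = 0) \<and> (\<exists>r\<in>?I. v r \<noteq> 0)" by blast
    then obtain v where ker: "\<And>t r. r \<in> ?I \<Longrightarrow> mat_vec ?I (?G t) (v t) r = 0"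
      and nz: "\<And>t. \<exists>r\<in>?I. v t r \<noteq> 0" by metis
    have zero: "dot ?I u (mat_vec ?I (?G t) (v t)) = 0" for u t
      using ker by (simp add: dot_def)
    have orth: "dot P (\<lambda>b. v s (N, b)) (\<lambda>b. v t (N, b)) = 0" if "s \<noteq> t" for s t
    proof -
      have "dot ?I (v s) (mat_vec ?I (?G 0) (v t)) = dot ?I (v t) (mat_vec ?I (?G 0) (v s))"
        by (rule mat_vec_self_adjoint[OF symmetric_on_shifted_hankel[OF sym]])
      then have "(s - t) * dot P (\<lambda>b. v s (N, b)) (\<lambda>b. v t (N, b)) = 0"
        using zero[of "v s" t] zero[of "v t" s]
          shifted_hankel_bilinear[OF fin, of N "v t" s T "v s",
            unfolded dot_commute[of P "\<lambda>b. v t (N, b)" "\<lambda>b. v s (N, b)"]]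
          shifted_hankel_bilinear[OF fin, of N "v s" t T "v t"]
        unfolding left_diff_distrib by linarith
      then show ?thesis using that by simp
    qed
    have "card (real ` {..card P}) \<le> card P"
      by (rule pairwise_orthogonal_card_le[OF fin, where y = "\<lambda>t b. v t (N, b)"])
        (use shifted_hankel_last_block_nonzero[OF pd ker nz] orth in auto)
    moreover have "card (real ` {..card P}) = Suc (card P)"
      by (subst card_image) (auto simp: inj_on_def)
    ultimately show False by simp
  qed
  then show ?thesis using that by blast
qed

text \<open>
  The atoms are the eigenvalues of the pencil, so they are indexed by \<open>{..N} \<times> P\<close> as well; some of
  them may coincide.
\<close>
theorem truncated_moment_problem_avoiding_0:
  assumes fin: "finite P" and pd: "pos_def_on ({..N} \<times> P) (hankel T)"
    and sym: "\<And>k. k \<le> 2 * N \<Longrightarrow> symmetric_on P (T k)"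
  obtains x w where "\<And>i. i \<in> {..N} \<times> P \<Longrightarrow> x i \<noteq> 0"
    "\<And>k a b. k \<le> 2 * N \<Longrightarrow> a \<in> P \<Longrightarrow> b \<in> P \<Longrightarrow>
      T k a b = (\<Sum>i\<in>{..N} \<times> P. x i ^ k * w i a * w i b)"
proof -
  let ?I = "{..N} \<times> P"
  obtain t where t: "\<And>v r. (\<And>r. r \<in> ?I \<Longrightarrow>
      mat_vec ?I (shifted_hankel N t T) v r = 0) \<Longrightarrow> r \<in> ?I \<Longrightarrow> v r = 0"
    using nonsingular_shifted_hankel[OF fin pd sym] by blast
  define G where "G = shifted_hankel N t T"
  define H where "H = hankel T"
  have finI: "finite ?I" using fin by simp
  have symH: "symmetric_on ?I H"
    unfolding H_def by (rule symmetric_on_hankel) (rule sym)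
  have symG: "symmetric_on ?I G"
    unfolding G_def by (rule symmetric_on_shifted_hankel) (rule sym)
  obtain x c v where
    dual: "\<And>i j. i \<in> ?I \<Longrightarrow> j \<in> ?I \<Longrightarrow> dot ?I (v i) (c j) = of_bool (i = j)" and
    decH: "\<And>r s. r \<in> ?I \<Longrightarrow> s \<in> ?I \<Longrightarrow> H r s = (\<Sum>i\<in>?I. c i r * c i s)" and
    decG: "\<And>r s. r \<in> ?I \<Longrightarrow> s \<in> ?I \<Longrightarrow> G r s = (\<Sum>i\<in>?I. x i * c i r * c i s)"
    using simultaneous_diagonalization[OF finI pd[folded H_def] symH symG] by blast
  have mat_vec_dec: "mat_vec ?I K (v i) r = y i * c i r"
    if K: "\<And>r s. r \<in> ?I \<Longrightarrow> s \<in> ?I \<Longrightarrow> K r s = (\<Sum>i\<in>?I. y i * c i r * c i s)"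
      and i: "i \<in> ?I" and r: "r \<in> ?I" for K y i r
  proof -
    have "mat_vec ?I K (v i) r = (\<Sum>s\<in>?I. \<Sum>j\<in>?I. y j * c j r * (v i s * c j s))"
      unfolding mat_vec_def using r by (intro sum.cong refl) (simp only: K sum_distrib_left sum_distrib_right mult_ac)
    also have "\<dots> = (\<Sum>j\<in>?I. \<Sum>s\<in>?I. y j * c j r * (v i s * c j s))"
      by (rule sum.swap)
    also have "\<dots> = (\<Sum>j\<in>?I. y j * c j r * dot ?I (v i) (c j))"
      by (simp add: dot_def sum_distrib_left)
    also have "\<dots> = (\<Sum>j\<in>?I. if j = i then y i * c i r else 0)"
      using dual i by (intro sum.cong refl) auto
    finally show ?thesis using i finI by simp
  qed
  have Hv: "mat_vec ?I H (v i) r = c i r" if "i \<in> ?I" "r \<in> ?I" for i r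
    using mat_vec_dec[of H "\<lambda>_. 1"] decH that by simp
  have Gv: "mat_vec ?I G (v i) r = x i * c i r" if "i \<in> ?I" "r \<in> ?I" for i r
    using mat_vec_dec[of G x] decG that by simp
  have x: "x i \<noteq> 0" if i: "i \<in> ?I" for i
  proof
    assume "x i = 0"
    then have "v i r = 0" if "r \<in> ?I" for r
      using t[of "v i" r] Gv[OF i] that unfolding G_def by auto
    then have "dot ?I (v i) (c i) = 0" by (simp add: dot_def)
    then show False using dual[OF i i] by simp
  qed
  have shift: "c i (Suc m, a) = x i * c i (m, a)" if "i \<in> ?I" "m < N" "a \<in> P" for i m a
  proof -
    have "mat_vec ?I G (v i) (m, a) = mat_vec ?I H (v i) (Suc m, a)"
      unfolding G_def H_def shifted_hankel_def mat_vec_hankel using that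
      by (intro sum.cong refl) auto
    then show ?thesis using Hv[of i "(Suc m, a)"] Gv[of i "(m, a)"] that by simp
  qed
  have pow: "c i (m, a) = x i ^ m * c i (0, a)" if "i \<in> ?I" "m \<le> N" "a \<in> P" for i m a
    using that(2) by (induction m) (use shift that in auto)
  show ?thesis
  proof (rule that[of x "\<lambda>i a. c i (0, a)"])
    fix k a b assume k: "k \<le> 2 * N" and ab: "a \<in> P" "b \<in> P"
    \<comment> \<open>Any splitting of \<open>k\<close> into two block indices will do.\<close>
    define m l where "m = min k N" and "l = k - m"
    have ml: "m \<le> N" "l \<le> N" "k = m + l" using k by (auto simp: m_def l_def)
    have "T k a b = H (m, a) (l, b)" by (simp add: H_def hankel_def ml)
    also have "\<dots> = (\<Sum>i\<in>?I. c i (m, a) * c i (l, b))"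
      using ml ab by (intro decH) auto
    also have "\<dots> = (\<Sum>i\<in>?I. x i ^ k * c i (0, a) * c i (0, b))"
    proof (intro sum.cong refl)
      fix i assume i: "i \<in> ?I"
      show "c i (m, a) * c i (l, b) = x i ^ k * c i (0, a) * c i (0, b)"
        unfolding pow[OF i ml(1) ab(1)] pow[OF i ml(2) ab(2)] ml(3) power_add by (simp only: mult_ac)
    qed
    finally show "T k a b = (\<Sum>i\<in>?I. x i ^ k * c i (0, a) * c i (0, b))" .
  qed (use x in auto)
qed

section \<open>Finitely atomic measures\<close>

text \<open>
  Negative weights count as 0, because \<open>ennreal\<close> truncates them. So the positive variation of an
  atomic signed measure is given by the same weights.
\<close>
definition atomic_measure :: "'a::topological_space set \<Rightarrow> ('a \<Rightarrow> real) \<Rightarrow> 'a measure" where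
  "atomic_measure X f = distr (point_measure X (\<lambda>x. ennreal (f x))) borel (\<lambda>x. x)"

lemma sets_atomic_measure [simp, measurable_cong]: "sets (atomic_measure X f) = sets borel"
  and space_atomic_measure [simp]: "space (atomic_measure X f) = UNIV"
  by (simp_all add: atomic_measure_def)

lemma emeasure_atomic_measure:
  assumes "finite X" "A \<in> sets borel"
  shows "emeasure (atomic_measure X f) A = (\<Sum>x\<in>X \<inter> A. ennreal (f x))"
  using assms
  by (simp add: atomic_measure_def emeasure_distr emeasure_point_measure_finite space_point_measure
      Int_commute)

lemma measure_of_eq_atomic_measure:
  assumes "finite X"
    and "\<And>A. A \<in> sets borel \<Longrightarrow> m A = (\<Sum>x\<in>X \<inter> A. ennreal (f x))"
  shows "measure_of UNIV (sets borel) m = atomic_measure X f"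
proof -
  have "measure_of UNIV (sets borel) m =
      measure_of (space (atomic_measure X f)) (sets (atomic_measure X f)) (emeasure (atomic_measure X f))"
    unfolding space_atomic_measure sets_atomic_measure
  proof (rule measure_of_eq)
    fix A :: "'a set" assume "A \<in> sigma_sets UNIV (sets borel)"
    then have "A \<in> sets borel" using sets.sigma_sets_eq[of "borel :: 'a measure"] by simp
    then show "m A = emeasure (atomic_measure X f) A"
      using assms by (simp add: emeasure_atomic_measure)
  qed simp
  then show ?thesis by (simp only: measure_of_of_measure)
qed

lemma integral_atomic_measure:
  fixes g :: "'a::topological_space \<Rightarrow> real"
  assumes X: "finite X" and g: "g \<in> borel_measurable borel"
  shows "integral\<^sup>L (atomic_measure X f) g = (\<Sum>x\<in>X. max 0 (f x) * g x)"
proof -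
  have "integral\<^sup>L (atomic_measure X f) g = integral\<^sup>L (point_measure X (\<lambda>x. ennreal (f x))) g"
    unfolding atomic_measure_def by (rule integral_distr) (use g in auto)
  also have "(\<lambda>x. ennreal (f x)) = (\<lambda>x. ennreal (max 0 (f x)))"
    by (auto simp: max_def ennreal_neg)
  finally show ?thesis
    using lebesgue_integral_point_measure_finite[OF X, of "\<lambda>x. max 0 (f x)" g] by simp
qed

lemma integrable_atomic_measure:
  fixes g :: "'a::topological_space \<Rightarrow> real"
  assumes X: "finite X" and g: "g \<in> borel_measurable borel"
  shows "integrable (atomic_measure X f) g"
proof -
  have "(\<lambda>x. ennreal (f x)) = (\<lambda>x. ennreal (max 0 (f x)))"
    by (auto simp: max_def ennreal_neg)
  then have "integrable (point_measure X (\<lambda>x. ennreal (f x))) g"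
    using integrable_point_measure_finite[OF X, of "\<lambda>x. max 0 (f x)" g] by simp
  then show ?thesis
    unfolding atomic_measure_def using g by (subst integrable_distr_eq) auto
qed

text \<open>
  The supremum over the Borel subsets of \<open>A\<close> is attained at the finite set of the atoms in \<open>A\<close> with
  positive weight.
\<close>
lemma positive_variation_atomic:
  fixes X :: "'a::t1_space set"
  assumes X: "finite X"
  shows "positive_variation borel (\<lambda>A. \<Sum>x\<in>X. f x * indicator A x) = atomic_measure X f"
  unfolding positive_variation_def space_borel
proof (rule measure_of_eq_atomic_measure[OF X])
  fix A :: "'a set" assume A: "A \<in> sets borel"
  let ?m = "\<lambda>A. \<Sum>x\<in>X. f x * indicator A x"
  have pos: "(\<Sum>x\<in>X \<inter> A. ennreal (f x)) = ennreal (\<Sum>x\<in>X \<inter> A. max 0 (f x))"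
  proof -
    have "(\<Sum>x\<in>X \<inter> A. ennreal (f x)) = (\<Sum>x\<in>X \<inter> A. ennreal (max 0 (f x)))"
      by (intro sum.cong refl) (auto simp: max_def ennreal_neg)
    then show ?thesis by (simp add: sum_ennreal)
  qed
  show "(SUP B \<in> {B \<in> sets borel. B \<subseteq> A}. ennreal (?m B)) = (\<Sum>x\<in>X \<inter> A. ennreal (f x))"
  proof (rule antisym)
    show "(SUP B \<in> {B \<in> sets borel. B \<subseteq> A}. ennreal (?m B)) \<le> (\<Sum>x\<in>X \<inter> A. ennreal (f x))"
    proof (rule SUP_least)
      fix B assume "B \<in> {B \<in> sets borel. B \<subseteq> A}"
      then have "?m B \<le> (\<Sum>x\<in>X. if x \<in> A then max 0 (f x) else 0)"
        by (intro sum_mono) (auto simp: indicator_def)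
      also have "\<dots> = (\<Sum>x\<in>X \<inter> A. max 0 (f x))"
        using X by (simp add: sum.inter_restrict)
      finally show "ennreal (?m B) \<le> (\<Sum>x\<in>X \<inter> A. ennreal (f x))"
        unfolding pos by (rule ennreal_leI)
    qed
    let ?B = "{x \<in> X. 0 < f x} \<inter> A"
    have "?B \<in> sets borel" using X A by (intro sets.Int borel_closed finite_imp_closed) auto
    moreover have "?m ?B = (\<Sum>x\<in>X. if x \<in> A then max 0 (f x) else 0)"
      by (intro sum.cong refl) (auto simp: indicator_def)
    then have "?m ?B = (\<Sum>x\<in>X \<inter> A. max 0 (f x))"
      using X by (simp add: sum.inter_restrict)
    ultimately show "(\<Sum>x\<in>X \<inter> A. ennreal (f x)) \<le> (SUP B \<in> {B \<in> sets borel. B \<subseteq> A}. ennreal (?m B))"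
      unfolding pos by (intro SUP_upper2[of ?B]) auto
  qed
qed

text \<open>
  Families of atoms may contain repetitions, whereas the Jordan decomposition needs the total weight of
  each point: weights of opposite sign at the same point cancel.
\<close>
lemma sum_over_distinct_values:
  fixes b :: "'i \<Rightarrow> real"
  assumes "finite I"
  shows "(\<Sum>i\<in>I. b i * h (x i)) = (\<Sum>y\<in>x ` I. (\<Sum>i\<in>{i\<in>I. x i = y}. b i) * h y)"
proof -
  have "(\<Sum>i\<in>I. b i * h (x i)) = (\<Sum>y\<in>x ` I. \<Sum>i\<in>{i\<in>I. x i = y}. b i * h (x i))"
    using assms by (rule sum.image_gen)
  also have "\<dots> = (\<Sum>y\<in>x ` I. \<Sum>i\<in>{i\<in>I. x i = y}. b i * h y)"
    by (intro sum.cong refl) auto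
  finally show ?thesis by (simp add: sum_distrib_right)
qed

lemma signed_integral_atomic:
  fixes x :: "'i \<Rightarrow> 'a::t1_space" and b :: "'i \<Rightarrow> real"
  assumes I: "finite I" and g: "g \<in> borel_measurable borel"
  shows "signed_integral borel (\<lambda>A. \<Sum>i\<in>I. b i * indicator A (x i)) g = (\<Sum>i\<in>I. b i * g (x i))"
proof -
  define f where "f = (\<lambda>y. \<Sum>i\<in>{i\<in>I. x i = y}. b i)"
  have X: "finite (x ` I)" using I by simp
  have "(\<Sum>i\<in>I. b i * indicator A (x i)) = (\<Sum>y\<in>x ` I. f y * indicator A y)" for A
    unfolding f_def by (rule sum_over_distinct_values[OF I])
  moreover from this have "- (\<Sum>i\<in>I. b i * indicator A (x i)) = (\<Sum>y\<in>x ` I. - f y * indicator A y)" for A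
    by (simp add: sum_negf)
  ultimately have "signed_integral borel (\<lambda>A. \<Sum>i\<in>I. b i * indicator A (x i)) g =
      (\<Sum>y\<in>x ` I. max 0 (f y) * g y) - (\<Sum>y\<in>x ` I. max 0 (- f y) * g y)"
    unfolding signed_integral_def
    by (simp only: positive_variation_atomic[OF X] integral_atomic_measure[OF X g])
  also have "\<dots> = (\<Sum>y\<in>x ` I. f y * g y)"
    unfolding sum_subtractf[symmetric] left_diff_distrib[symmetric]
    by (intro sum.cong refl) (auto simp: max_def)
  also have "\<dots> = (\<Sum>i\<in>I. b i * g (x i))"
    unfolding f_def by (rule sum_over_distinct_values[OF I, symmetric])
  finally show ?thesis .
qed

lemma signed_measure_atomic:
  fixes b :: "'i \<Rightarrow> real"
  shows "signed_measure M (\<lambda>A. \<Sum>i\<in>I. b i * indicator A (x i))"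
  unfolding signed_measure_def
proof (intro conjI allI impI)
  fix A :: "nat \<Rightarrow> 'a set" assume "disjoint_family A"
  then have "(\<lambda>n. indicator (A n) y :: real) sums indicator (\<Union>n. A n) y" for y
    by (intro indicator_sums) (auto simp: disjoint_family_on_def)
  then show "(\<lambda>n. \<Sum>i\<in>I. b i * indicator (A n) (x i)) sums (\<Sum>i\<in>I. b i * indicator (\<Union>n. A n) (x i))"
    by (intro sums_sum sums_mult)
qed simp

section \<open>Finitely atomic matrix measures\<close>

definition atomic_matrix_measure ::
    "nat \<Rightarrow> 'i set \<Rightarrow> ('i \<Rightarrow> real) \<Rightarrow> ('i \<Rightarrow> nat \<Rightarrow> real) \<Rightarrow> real set \<Rightarrow> real mat" where
  "atomic_matrix_measure p I x w \<Delta> =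
     mat p p (\<lambda>(a, b). \<Sum>i\<in>I. w i a * w i b * indicator \<Delta> (x i))"

lemma quadratic_form_mat:
  assumes v: "v \<in> carrier_vec n" and A: "A \<in> carrier_mat n n"
  shows "scalar_prod v (A *\<^sub>v v) = (\<Sum>r<n. \<Sum>s<n. v $ r * A $$ (r, s) * v $ s)"
  using v A
  by (auto simp: scalar_prod_def sum_distrib_left mult.assoc lessThan_atLeast0 intro!: sum.cong)

lemma positive_semidefinite_atomic:
  "positive_semidefinite p (atomic_matrix_measure p I x w \<Delta>)"
  unfolding positive_semidefinite_def
proof (intro conjI ballI)
  show "atomic_matrix_measure p I x w \<Delta> \<in> symmetric_mats p"
    by (auto simp: symmetric_mats_def atomic_matrix_measure_def mult.commute intro!: eq_matI)
  fix v :: "real vec" assume v: "v \<in> carrier_vec p"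
  have "scalar_prod v (atomic_matrix_measure p I x w \<Delta> *\<^sub>v v) =
      (\<Sum>a<p. \<Sum>b<p. \<Sum>i\<in>I. indicator \<Delta> (x i) * ((v $ a * w i a) * (v $ b * w i b)))"
    by (subst quadratic_form_mat[OF v])
      (auto simp: atomic_matrix_measure_def sum_distrib_left sum_distrib_right mult_ac intro!: sum.cong)
  also have "\<dots> = (\<Sum>a<p. \<Sum>i\<in>I. \<Sum>b<p. indicator \<Delta> (x i) * ((v $ a * w i a) * (v $ b * w i b)))"
    by (intro sum.cong refl sum.swap)
  also have "\<dots> = (\<Sum>i\<in>I. \<Sum>a<p. \<Sum>b<p. indicator \<Delta> (x i) * ((v $ a * w i a) * (v $ b * w i b)))"
    by (rule sum.swap)
  also have "\<dots> = (\<Sum>i\<in>I. indicator \<Delta> (x i) * (\<Sum>a<p. v $ a * w i a)\<^sup>2)"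
    unfolding power2_eq_square sum_product by (simp only: sum_distrib_left)
  also have "0 \<le> \<dots>" by (intro sum_nonneg mult_nonneg_nonneg) auto
  finally show "0 \<le> scalar_prod v (atomic_matrix_measure p I x w \<Delta> *\<^sub>v v)" .
qed

lemma positive_matrix_measure_atomic:
  "positive_matrix_measure p (atomic_matrix_measure p I x w)"
  unfolding positive_matrix_measure_def
  using signed_measure_atomic[of borel "\<lambda>i. w i _ * w i _" x I]
  by (auto simp: positive_semidefinite_atomic) (simp add: atomic_matrix_measure_def)

lemma trace_measure_atomic:
  assumes I: "finite I"
  shows "trace_measure p (atomic_matrix_measure p I x w) =
    atomic_measure (x ` I) (\<lambda>y. \<Sum>i\<in>{i\<in>I. x i = y}. \<Sum>a<p. (w i a)\<^sup>2)"
  unfolding trace_measure_def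
proof (rule measure_of_eq_atomic_measure)
  show "finite (x ` I)" using I by simp
  let ?f = "\<lambda>y. \<Sum>i\<in>{i\<in>I. x i = y}. \<Sum>a<p. (w i a)\<^sup>2"
  fix A :: "real set"
  have "(\<Sum>a<p. atomic_matrix_measure p I x w A $$ (a, a)) = (\<Sum>a<p. \<Sum>i\<in>I. (w i a)\<^sup>2 * indicator A (x i))"
    by (simp add: atomic_matrix_measure_def power2_eq_square)
  also have "\<dots> = (\<Sum>i\<in>I. (\<Sum>a<p. (w i a)\<^sup>2) * indicator A (x i))"
    by (subst sum.swap) (simp add: sum_distrib_right)
  also have "\<dots> = (\<Sum>y\<in>x ` I. ?f y * indicator A y)"
    by (rule sum_over_distinct_values[OF I])
  also have "\<dots> = (\<Sum>y\<in>x ` I. if y \<in> A then ?f y else 0)"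
    by (intro sum.cong refl) (auto simp: indicator_def)
  also have "\<dots> = (\<Sum>y\<in>x ` I \<inter> A. ?f y)"
    using I by (simp add: sum.inter_restrict)
  finally show "ennreal (\<Sum>a<p. atomic_matrix_measure p I x w A $$ (a, a)) = (\<Sum>y\<in>x ` I \<inter> A. ennreal (?f y))"
    by (simp add: sum_ennreal sum_nonneg)
qed

lemma borel_measurable_powi: "(\<lambda>x::real. x powi k) \<in> borel_measurable borel"
  by (cases "0 \<le> k") (simp_all add: power_int_def)

lemma has_matrix_moment_atomic:
  assumes I: "finite I" and nz: "\<And>i. i \<in> I \<Longrightarrow> x i \<noteq> 0"
  shows "has_matrix_moment p (atomic_matrix_measure p I x w) k
    (mat p p (\<lambda>(a, b). \<Sum>i\<in>I. w i a * w i b * x i powi k))"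
  unfolding has_matrix_moment_def
proof (intro conjI impI)
  show "atomic_matrix_measure p I x w {0} = 0\<^sub>m p p"
    using nz by (intro eq_matI) (auto simp: atomic_matrix_measure_def intro!: sum.neutral)
  show "integrable (trace_measure p (atomic_matrix_measure p I x w)) (\<lambda>x. x powi k)"
    unfolding trace_measure_atomic[OF I]
    by (rule integrable_atomic_measure) (use I borel_measurable_powi in auto)
  show "mat p p (\<lambda>(a, b). \<Sum>i\<in>I. w i a * w i b * x i powi k) =
      matrix_integral p (atomic_matrix_measure p I x w) (\<lambda>x. x powi k)"
    unfolding matrix_integral_def
  proof (rule cong_mat)
    fix a b assume ab: "a < p" "b < p"
    then have "(\<lambda>\<Delta>. atomic_matrix_measure p I x w \<Delta> $$ (a, b)) =
        (\<lambda>\<Delta>. \<Sum>i\<in>I. w i a * w i b * indicator \<Delta> (x i))"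
      by (simp add: atomic_matrix_measure_def)
    then show "(case (a, b) of (a, b) \<Rightarrow> \<Sum>i\<in>I. w i a * w i b * x i powi k) =
      (case (a, b) of (a, b) \<Rightarrow>
        signed_integral borel (\<lambda>\<Delta>. atomic_matrix_measure p I x w \<Delta> $$ (a, b)) (\<lambda>x. x powi k))"
      by (simp add: signed_integral_atomic[OF I borel_measurable_powi])
  qed simp_all
qed

section \<open>From block matrices to Hankel forms\<close>

lemma bij_betw_block_index:
  assumes "0 < p"
  shows "bij_betw (\<lambda>r. (r div p, r mod p)) {..<Suc N * p} ({..N} \<times> {..<p})"
proof (rule bij_betw_byWitness[where f' = "\<lambda>(m, a). m * p + a"])
  have "r div p \<le> N" if "r < Suc N * p" for r
    using less_mult_imp_div_less[OF that] by simp
  then show "(\<lambda>r. (r div p, r mod p)) ` {..<Suc N * p} \<subseteq> {..N} \<times> {..<p}"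
    using assms by auto
  have "m * p + a < Suc N * p" if "m \<le> N" "a < p" for m a
  proof -
    have "m * p \<le> N * p" using that(1) by (rule mult_le_mono1)
    then show ?thesis using that(2) unfolding mult_Suc by linarith
  qed
  then show "(\<lambda>(m, a). m * p + a) ` ({..N} \<times> {..<p}) \<subseteq> {..<Suc N * p}"
    by auto
qed (use assms in auto)

lemma pos_def_on_of_block_hankel:
  assumes p: "0 < p"
    and pd: "positive_definite (Suc N * p) (block_matrix (Suc N) p B)"
    and B: "\<And>m l a b. m \<le> N \<Longrightarrow> l \<le> N \<Longrightarrow> a < p \<Longrightarrow> b < p \<Longrightarrow>
      B (m + 1) (l + 1) $$ (a, b) = T (m + l) a b"
  shows "pos_def_on ({..N} \<times> {..<p}) (hankel T)"
  unfolding pos_def_on_def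
proof (intro allI impI)
  let ?I = "{..N} \<times> {..<p}" and ?n = "Suc N * p"
  define \<iota> where "\<iota> = (\<lambda>r. (r div p, r mod p))"
  have bij: "bij_betw \<iota> {..<?n} ?I" unfolding \<iota>_def by (rule bij_betw_block_index[OF p])
  fix v :: "nat \<times> nat \<Rightarrow> real" assume "\<exists>i\<in>?I. v i \<noteq> 0"
  then have "\<exists>i\<in>\<iota> ` {..<?n}. v i \<noteq> 0"
    unfolding bij_betw_imp_surj_on[OF bij] .
  then obtain r where r: "r < ?n" "v (\<iota> r) \<noteq> 0" by blast
  define u where "u = vec ?n (\<lambda>r. v (\<iota> r))"
  have u: "u \<in> carrier_vec ?n" by (simp add: u_def)
  have "u $ r \<noteq> 0" using r by (simp add: u_def)
  then have "u \<noteq> 0\<^sub>v ?n" using r by (metis index_zero_vec(1))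
  then have "0 < scalar_prod u (block_matrix (Suc N) p B *\<^sub>v u)"
    using pd u by (auto simp: positive_definite_def)
  also have "\<dots> = (\<Sum>r<?n. \<Sum>s<?n. v (\<iota> r) * hankel T (\<iota> r) (\<iota> s) * v (\<iota> s))"
  proof -
    have entry: "block_matrix (Suc N) p B $$ (r, s) = hankel T (\<iota> r) (\<iota> s)" if "r < ?n" "s < ?n" for r s
    proof -
      have "\<iota> r \<in> ?I" "\<iota> s \<in> ?I" using bij that by (auto simp: bij_betw_def)
      then show ?thesis
        using that B[of "r div p" "s div p" "r mod p" "s mod p"]
        by (simp add: block_matrix_def hankel_def \<iota>_def)
    qed
    have "block_matrix (Suc N) p B \<in> carrier_mat ?n ?n" by (simp add: block_matrix_def)
    from quadratic_form_mat[OF u this] show ?thesis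
      using entry by (simp add: u_def)
  qed
  also have "\<dots> = (\<Sum>r\<in>?I. \<Sum>s\<in>?I. v r * hankel T r s * v s)"
    by (subst sum.reindex_bij_betw[OF bij, symmetric], intro sum.cong refl,
        rule sum.reindex_bij_betw[OF bij])
  also have "\<dots> = dot ?I v (mat_vec ?I (hankel T) v)"
    by (simp add: dot_def mat_vec_def sum_distrib_left mult.assoc)
  finally show "0 < dot ?I v (mat_vec ?I (hankel T) v)" .
qed

theorem corollary1p3:
  fixes n1 n2 p :: nat and S :: "int \<Rightarrow> real mat"
  assumes "1 \<le> n1" and "1 \<le> n2" and "1 \<le> p"
    and "\<And>k. k \<in> {- 2 * int n1 .. 2 * int n2} \<Longrightarrow> S k \<in> symmetric_mats p"
    and "positive_definite ((n1 + n2 + 1) * p)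
           (block_matrix (n1 + n2 + 1) p (\<lambda>i j. S (int i + int j - 2 - 2 * int n1)))"
  shows "\<exists>\<mu>. positive_matrix_measure p \<mu> \<and>
           (\<forall>k \<in> {- 2 * int n1 .. 2 * int n2}. has_matrix_moment p \<mu> k (S k))"
proof -
  define N where "N = n1 + n2"
  define T where "T = (\<lambda>m a b. S (int m - 2 * int n1) $$ (a, b))"
  let ?I = "{..N} \<times> {..<p}"
  have pd: "pos_def_on ?I (hankel T)"
  proof (rule pos_def_on_of_block_hankel)
    show "positive_definite (Suc N * p)
        (block_matrix (Suc N) p (\<lambda>i j. S (int i + int j - 2 - 2 * int n1)))"
      using assms(5) by (simp add: N_def)
  qed (use assms(3) in \<open>auto simp: T_def add.commute\<close>)
  have sym: "symmetric_on {..<p} (T k)" if "k \<le> 2 * N" for k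
  proof -
    have "S (int k - 2 * int n1) \<in> symmetric_mats p"
      using that by (intro assms(4)) (auto simp: N_def)
    then have S: "S (int k - 2 * int n1) \<in> carrier_mat p p"
      "transpose_mat (S (int k - 2 * int n1)) = S (int k - 2 * int n1)"
      by (auto simp: symmetric_mats_def)
    show ?thesis
      unfolding symmetric_on_def T_def
    proof (intro ballI)
      fix a b assume "a \<in> {..<p}" "b \<in> {..<p}"
      then show "S (int k - 2 * int n1) $$ (a, b) = S (int k - 2 * int n1) $$ (b, a)"
        using S(1) by (subst S(2)[symmetric]) auto
    qed
  qed
  obtain x w where x: "\<And>i. i \<in> ?I \<Longrightarrow> x i \<noteq> 0"
    and T: "\<And>k a b. k \<le> 2 * N \<Longrightarrow> a \<in> {..<p} \<Longrightarrow> b \<in> {..<p} \<Longrightarrow>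
      T k a b = (\<Sum>i\<in>?I. x i ^ k * w i a * w i b)"
    by (rule truncated_moment_problem_avoiding_0[OF _ pd sym]) auto
  \<comment> \<open>Multiplying the weight \<open>w\<^sub>i w\<^sub>i\<^sup>T\<close> by the density \<open>x\<^sub>i^(2 * n1)\<close> keeps its form \<open>w' w'\<^sup>T\<close>.\<close>
  define w' where "w' = (\<lambda>i a. w i a * x i ^ n1)"
  let ?\<mu> = "atomic_matrix_measure p ?I x w'"
  have "has_matrix_moment p ?\<mu> k (S k)" if k: "k \<in> {- 2 * int n1 .. 2 * int n2}" for k
  proof -
    define m where "m = nat (k + 2 * int n1)"
    have m: "m \<le> 2 * N" "k = int m - 2 * int n1" using k by (auto simp: m_def N_def)
    have "S k = mat p p (\<lambda>(a, b). \<Sum>i\<in>?I. w' i a * w' i b * x i powi k)"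
    proof (rule eq_matI)
      fix a b assume "a < dim_row (mat p p (\<lambda>(a, b). \<Sum>i\<in>?I. w' i a * w' i b * x i powi k))"
        "b < dim_col (mat p p (\<lambda>(a, b). \<Sum>i\<in>?I. w' i a * w' i b * x i powi k))"
      then have ab: "a < p" "b < p" by auto
      have "S k $$ (a, b) = (\<Sum>i\<in>?I. x i ^ m * w i a * w i b)"
        using T[OF m(1), of a b] ab by (simp add: T_def m(2))
      also have "\<dots> = (\<Sum>i\<in>?I. w' i a * w' i b * x i powi k)"
      proof (intro sum.cong refl)
        fix i assume "i \<in> ?I"
        then have "x i \<noteq> 0" by (rule x)
        then have "x i ^ n1 * x i ^ n1 * x i powi k = x i powi (int n1 + int n1 + k)"
          by (simp only: power_int_add power_int_of_nat simp_thms)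
        also have "\<dots> = x i ^ m" by (simp add: m(2))
        finally have "x i ^ n1 * x i ^ n1 * x i powi k = x i ^ m" .
        then show "x i ^ m * w i a * w i b = w' i a * w' i b * x i powi k"
          by (simp add: w'_def mult_ac)
      qed
      finally show "S k $$ (a, b) = mat p p (\<lambda>(a, b). \<Sum>i\<in>?I. w' i a * w' i b * x i powi k) $$ (a, b)"
        using ab by simp
    qed (use assms(4)[OF k] in \<open>auto simp: symmetric_mats_def\<close>)
    then show ?thesis using has_matrix_moment_atomic[of ?I x p w' k] x by simp
  qed
  then show ?thesis using positive_matrix_measure_atomic by blast
qed

end
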